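(* Let $H$ be a hierarchical hub labeling of a tree $T$ on $n$ vertices that is optimal for HL$_1$ (i.e. $\sum_u|H_u|$ is minimum among all hub labelings of $T$). Then $\max_{u\in T}|H_u|=O(\log n)$.
   Context: For a tree $T=(V,E)$ and $u,v\in V$, let $P_{uv}$ be the vertex set of the unique $u$–$v$ path ($P_{uu}=\{u\}$). A hub labeling of $T$ is a family $\{H_u\}_{u\in V}$ of subsets of $V$ with $H_u\cap H_v\cap P_{uv}\neq\varnothing$ for all $u,v\in V$ (including $u=v$). HL$_1$ is the problem of minimizing $\sum_{u\in V}|H_u|$. Writing $u\preceq v$ if $u\in H_v$, the labeling is hierarchical if $\preceq$ is a partial order on $V$. *)

theory Defs
  imports "Graph_Theory.Graph_Theory" "HOL-Library.Landau_Symbols"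
begin

text \<open>
  Undirected graphs are finite, symmetric, loop-free digraphs (\<open>pair_graph\<close>). The library
  predicate \<open>tree\<close> cannot be used for them: it excludes every directed cycle, hence also the
  back-and-forth traversal \<open>u, v, u\<close> of a single edge. In a \<open>pair_graph\<close> the directed cycles of
  length at least 3 are exactly the traversals of the cycles of the undirected graph.
  Connectedness includes that the vertex set is nonempty.
\<close>

definition undirected_tree :: "'a pair_pre_digraph \<Rightarrow> bool" where
  "undirected_tree T \<longleftrightarrow>
     pair_graph T \<and> connected (with_proj T) \<and>
     \<not> (\<exists>p. pre_digraph.cycle (with_proj T) p \<and> 3 \<le> length p)"

definition path_verts :: "'a pair_pre_digraph \<Rightarrow> 'a \<Rightarrow> 'a \<Rightarrow> 'a set" where
  "path_verts T u v = set (THE p. vpath p (with_proj T) \<and> hd p = u \<and> last p = v)"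

text \<open>
  A labeling is a total function on the vertex type; only its values on \<open>pverts T\<close> matter.
\<close>

definition hub_labeling :: "'a pair_pre_digraph \<Rightarrow> ('a \<Rightarrow> 'a set) \<Rightarrow> bool" where
  "hub_labeling T H \<longleftrightarrow>
     (\<forall>u \<in> pverts T. H u \<subseteq> pverts T) \<and>
     (\<forall>u \<in> pverts T. \<forall>v \<in> pverts T. H u \<inter> H v \<inter> path_verts T u v \<noteq> {})"

definition HL1_cost :: "'a pair_pre_digraph \<Rightarrow> ('a \<Rightarrow> 'a set) \<Rightarrow> nat" where
  "HL1_cost T H = (\<Sum>u \<in> pverts T. card (H u))"

definition HL1_optimal :: "'a pair_pre_digraph \<Rightarrow> ('a \<Rightarrow> 'a set) \<Rightarrow> bool" where
  "HL1_optimal T H \<longleftrightarrow>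
     hub_labeling T H \<and> (\<forall>H'. hub_labeling T H' \<longrightarrow> HL1_cost T H \<le> HL1_cost T H')"

definition hub_rel :: "'a pair_pre_digraph \<Rightarrow> ('a \<Rightarrow> 'a set) \<Rightarrow> 'a rel" where
  "hub_rel T H = {(u, v). u \<in> pverts T \<and> v \<in> pverts T \<and> u \<in> H v}"

definition hierarchical :: "'a pair_pre_digraph \<Rightarrow> ('a \<Rightarrow> 'a set) \<Rightarrow> bool" where
  "hierarchical T H \<longleftrightarrow> partial_order_on (pverts T) (hub_rel T H)"

end

(*
  Write c \<in> P u x for "the path from u to x passes through c". In a convex vertex set S whose pairs
  leaving S are served by hubs outside S, one vertex c of S can be promoted: every u in S drops
  the hubs x in S that lie beyond c and gains c. By optimality the number of pairs
  (u, x), u in S, x a hub of u in S beyond c, is therefore at most |S|.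

  A hierarchical labeling has in each S a vertex r that is a hub of all of S. Promoting r shows that
  the hubs of u in S are r and the hubs in the component of u in S - r, which again
  has the property required of S, so hub sets are root-to-vertex chains of a decomposition.
  If after four steps of it a set S' remains, all of S' shares four hubs in S; promoting a
  centroid c of S, each of these hubs is beyond c for at least |S'| - |S|/2 vertices of S', hence
  4 (|S'| - |S|/2) \<le> |S|, i.e. |S'| \<le> 3/4 |S|.
*)
theory Submission
  imports Defs
begin

subsection \<open>Medians and centroids in path systems\<close>

text \<open>Tree paths, known by their vertex sets only, so that lists and arcs stay out of the
  argument. Acyclicity enters through \<open>path_join\<close>: in a cycle, two shortest paths that
  meet only in w need not concatenate to a shortest path.\<close>

locale path_system =
  fixes V :: "'a set" and P :: "'a \<Rightarrow> 'a \<Rightarrow> 'a set"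
  assumes finite_V: "finite V"
    and path_subset: "\<lbrakk>u \<in> V; v \<in> V\<rbrakk> \<Longrightarrow> P u v \<subseteq> V"
    and start_in_path: "\<lbrakk>u \<in> V; v \<in> V\<rbrakk> \<Longrightarrow> u \<in> P u v"
    and path_commute: "\<lbrakk>u \<in> V; v \<in> V\<rbrakk> \<Longrightarrow> P u v = P v u"
    and path_split: "\<lbrakk>u \<in> V; v \<in> V; w \<in> P u v\<rbrakk> \<Longrightarrow> P u v = P u w \<union> P w v"
    and path_split_Int: "\<lbrakk>u \<in> V; v \<in> V; w \<in> P u v\<rbrakk> \<Longrightarrow> P u w \<inter> P w v = {w}"
    and path_join: "\<lbrakk>u \<in> V; v \<in> V; w \<in> V; P u w \<inter> P w v \<subseteq> {w}\<rbrakk> \<Longrightarrow> w \<in> P u v"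
begin

section \<open>Betweenness, medians and neighbours\<close>

lemma end_in_path: "\<lbrakk>u \<in> V; v \<in> V\<rbrakk> \<Longrightarrow> v \<in> P u v"
  using path_commute start_in_path by blast

lemma path_refl: "u \<in> V \<Longrightarrow> P u u = {u}"
  using path_split_Int[of u u u] start_in_path[of u u] by auto

lemma in_path_V: "\<lbrakk>u \<in> V; v \<in> V; w \<in> P u v\<rbrakk> \<Longrightarrow> w \<in> V"
  using path_subset by blast

lemma finite_path: "\<lbrakk>u \<in> V; v \<in> V\<rbrakk> \<Longrightarrow> finite (P u v)"
  using path_subset finite_V finite_subset by metis

text \<open>\<open>P w z\<close> is part of \<open>P w v\<close>, so it meets \<open>P u w\<close>
  only in w and the two pieces join. The order along the path is u, w, z, v.\<close>

lemma path_between: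
  assumes "u \<in> V" "v \<in> V" "w \<in> P u v" "z \<in> P w v"
  shows "w \<in> P u z"
proof -
  have w: "w \<in> V" using assms in_path_V by blast
  have z: "z \<in> V" using assms w in_path_V by blast
  have "P w z \<subseteq> P w v" using path_split[OF w assms(2,4)] by blast
  then have "P u w \<inter> P w z \<subseteq> {w}" using path_split_Int[OF assms(1-3)] by blast
  then show ?thesis by (rule path_join[OF assms(1) z w])
qed

text \<open>The median is the common vertex of the paths from w to u and from w to v that lies
  farthest from w. Behind it these two paths share nothing, so they join to the path from u to
  v.\<close>

lemma median_exists:
  assumes u: "u \<in> V" and v: "v \<in> V" and w: "w \<in> V"
  obtains m where "m \<in> P w u" "m \<in> P w v" "m \<in> P u v"
proof -
  let ?I = "P w u \<inter> P w v"
  have "w \<in> ?I" using start_in_path u v w by blast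
  moreover have "\<forall>z. z \<in> ?I \<longrightarrow> card (P w z) < Suc (card V)"
  proof (intro allI impI)
    fix z assume "z \<in> ?I"
    then have "z \<in> V" using in_path_V u w by blast
    then show "card (P w z) < Suc (card V)"
      using card_mono[OF finite_V path_subset[OF w]] by (simp add: less_Suc_eq_le)
  qed
  ultimately obtain m where m: "m \<in> ?I" and max: "\<And>z. z \<in> ?I \<Longrightarrow> card (P w z) \<le> card (P w m)"
    using arg_max_nat_lemma[of "\<lambda>z. z \<in> ?I" w "\<lambda>z. card (P w z)" "Suc (card V)"] by blast
  have mV: "m \<in> V" using m in_path_V u w by blast
  have "z = m" if z: "z \<in> P m u" "z \<in> P m v" for z
  proof -
    have zV: "z \<in> V" using z in_path_V u mV by blast
    have zI: "z \<in> ?I"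
      using path_split[OF w u, of m] path_split[OF w v, of m] m z by blast
    have "m \<in> P w z" using path_between[OF w u] m z by blast
    then have "P w z = P w m \<union> P m z" by (rule path_split[OF w zV])
    \<comment> \<open>By maximality, going on from m to z adds no vertex, so z already lies on
      \<open>P w m\<close>.\<close>
    moreover from this have "P w m = P w z"
      using max[OF zI] by (metis Un_upper1 card_seteq finite_path[OF w zV])
    ultimately have "z \<in> P w m" using end_in_path[OF mV zV] by blast
    then show ?thesis using path_split_Int[OF w u, of m] m z by blast
  qed
  then have "P u m \<inter> P m v \<subseteq> {m}" using path_commute[OF u mV] by blast
  then have "m \<in> P u v" by (rule path_join[OF u v mV])
  then show thesis using that m by blast
qed

text \<open>Cut \<open>P u v\<close> at the median: each half is part of a path to w.\<close>

lemma path_triangle: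
  assumes "u \<in> V" "v \<in> V" "w \<in> V"
  shows "P u v \<subseteq> P u w \<union> P w v"
proof -
  obtain m where m: "m \<in> P w u" "m \<in> P w v" "m \<in> P u v"
    using median_exists[OF assms] by blast
  have "P u v = P u m \<union> P m v" by (rule path_split[OF assms(1,2) m(3)])
  moreover have "P m v \<subseteq> P w v" using path_split[OF assms(3,2) m(2)] by blast
  moreover have "P u m \<subseteq> P u w"
    using path_split[OF assms(1,3), of m] path_commute[OF assms(1,3)] m(1) by blast
  ultimately show ?thesis by blast
qed

text \<open>Supplies the edges that a path system does not mention: d is the first vertex after c on
  the way to x, found by minimal \<open>card (P c d)\<close>.\<close>

lemma neighbour_exists:
  assumes "c \<in> V" "x \<in> V" "x \<noteq> c"
  obtains d where "d \<in> P c x" "d \<noteq> c" "P c d = {c, d}"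
proof -
  let ?I = "P c x - {c}"
  have I: "finite ?I" "?I \<noteq> {}" using assms finite_path end_in_path by blast+
  obtain d where d: "d \<in> ?I" and min: "\<And>z. z \<in> ?I \<Longrightarrow> card (P c d) \<le> card (P c z)"
    using ex_is_arg_min_if_finite[OF I, of "\<lambda>z. card (P c z)"]
    unfolding is_arg_min_linorder by metis
  have dV: "d \<in> V" using d assms in_path_V by blast
  have "s = d" if s: "s \<in> P c d" "s \<noteq> c" for s
  proof -
    have sV: "s \<in> V" using s in_path_V assms dV by blast
    have "s \<in> ?I" using path_split[OF assms(1,2), of d] d s by blast
    moreover have "P c s \<subseteq> P c d" using path_split[OF assms(1) dV s(1)] by blast
    ultimately have "P c s = P c d"
      using min card_seteq finite_path[OF assms(1) dV] by metis
    then have "d \<in> P c s" using end_in_path assms dV by blast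
    moreover have "d \<in> P s d" using end_in_path sV dV by blast
    ultimately show ?thesis using path_split_Int[OF assms(1) dV s(1)] by auto
  qed
  then have "P c d = {c, d}"
    using start_in_path end_in_path assms(1) dV by blast
  then show thesis using that d by blast
qed

section \<open>Convex sets, branches and centroids\<close>

definition convex :: "'a set \<Rightarrow> bool" where
  "convex S \<longleftrightarrow> S \<subseteq> V \<and> (\<forall>u\<in>S. \<forall>v\<in>S. P u v \<subseteq> S)"

text \<open>For convex S and distinct c, x in S this is the component of S - c that contains x; for
  x = c it is empty.\<close>

definition branch :: "'a set \<Rightarrow> 'a \<Rightarrow> 'a \<Rightarrow> 'a set" where
  "branch S c x = {u \<in> S. c \<notin> P u x}"

lemma convex_subset: "convex S \<Longrightarrow> S \<subseteq> V"
  by (simp add: convex_def)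

lemma convex_finite: "convex S \<Longrightarrow> finite S"
  using convex_subset finite_V finite_subset by blast

lemma branch_subset: "branch S c x \<subseteq> S"
  by (auto simp: branch_def)

lemma convex_branch:
  assumes S: "convex S" and x: "x \<in> S"
  shows "convex (branch S c x)"
  unfolding convex_def
proof (intro conjI ballI subsetI)
  fix u v z
  assume uv: "u \<in> branch S c x" "v \<in> branch S c x" and z: "z \<in> P u v"
  then have V: "u \<in> V" "v \<in> V" "x \<in> V" "z \<in> S"
    using S x unfolding convex_def branch_def by auto
  then have zV: "z \<in> V" using S convex_subset by blast
  have c: "c \<notin> P u x" "c \<notin> P v x" using uv by (auto simp: branch_def)
  have "z \<in> P u x \<or> z \<in> P v x"
    using path_triangle[of u v x] path_commute[of x v] V z by blast
  then have "c \<notin> P z x"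
    using path_split[of u x z] path_split[of v x z] V c by blast
  then show "z \<in> branch S c x" using V by (simp add: branch_def)
qed (use S branch_subset convex_subset in blast)

text \<open>If every vertex had a branch with more than half of S, take the smallest such branch, at
  c towards x, and step to the neighbour d of c towards x. The big branch at d either points back
  through c, and then it is disjoint from the first, which exceeds S; or it points away from c, and
  then it is properly contained in the first.\<close>

lemma centroid_exists:
  assumes S: "convex S" and "S \<noteq> {}"
  obtains c where "c \<in> S" "\<And>x. x \<in> S \<Longrightarrow> 2 * card (branch S c x) \<le> card S"
proof (rule ccontr)
  define big where "big c x \<longleftrightarrow> c \<in> S \<and> x \<in> S \<and> card S < 2 * card (branch S c x)" for c x
  assume "\<not> thesis"
  then have ex: "\<exists>x. big c x" if "c \<in> S" for c
    using that \<open>\<And>c. \<lbrakk>c \<in> S; \<And>x. x \<in> S \<Longrightarrow> 2 * card (branch S c x) \<le> card S\<rbrakk> \<Longrightarrow> thesis\<close>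
    unfolding big_def by (meson not_le)
  then obtain c0 x0 where "big c0 x0" using \<open>S \<noteq> {}\<close> by blast
  then obtain c x where b: "big c x"
    and min: "\<And>c' y. big c' y \<Longrightarrow> card (branch S c x) \<le> card (branch S c' y)"
    using ex_has_least_nat[of "\<lambda>q. big (fst q) (snd q)" "(c0, x0)" "\<lambda>q. card (branch S (fst q) (snd q))"]
    by auto
  have V: "c \<in> V" "x \<in> V" and cS: "c \<in> S" and xS: "x \<in> S"
    using b S convex_subset by (auto simp: big_def)
  have fin: "finite S" using S by (rule convex_finite)
  have "x \<noteq> c"
  proof
    assume "x = c"
    then have "branch S c x = {}" using end_in_path S convex_subset V by (auto simp: branch_def)
    then show False using b by (simp add: big_def)
  qed
  then obtain d where d: "d \<in> P c x" "d \<noteq> c" and Pcd: "P c d = {c, d}"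
    using neighbour_exists V by metis
  have dS: "d \<in> S" using d S cS xS by (auto simp: convex_def)
  have dV: "d \<in> V" using dS S convex_subset by blast
  \<comment> \<open>The median of c, d, y lies in \<open>P c d\<close>, so y is on one side of the
    edge.\<close>
  have side: "c \<in> P d y \<or> d \<in> P c y" if "y \<in> V" for y
    using median_exists[OF V(1) dV that] Pcd path_commute[OF that V(1)] path_commute[OF that dV]
    by (metis insertE singletonD)
  have cdx: "c \<notin> P d x" using path_split_Int[OF V d(1)] Pcd d(2) by auto
  obtain y where y: "big d y" using ex dS by blast
  then have yS: "y \<in> S" and yV: "y \<in> V" using S convex_subset by (auto simp: big_def)
  show False
  proof (cases "c \<in> P d y")
    case True
    have "u \<notin> branch S c x" if u: "u \<in> branch S d y" for u
    proof
      assume u': "u \<in> branch S c x"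
      have uV: "u \<in> V" using u S convex_subset by (auto simp: branch_def)
      have "c \<notin> P d u"
        using path_triangle[OF dV uV V(2)] cdx u' path_commute[OF uV V(2)] by (auto simp: branch_def)
      then have "d \<in> P u c" "c \<in> P u y"
        using side[OF uV] path_commute[OF uV V(1)] True path_triangle[OF dV yV uV] by auto
      then have "d \<in> P u y" using path_split[OF uV yV] by blast
      then show False using u by (simp add: branch_def)
    qed
    then have "branch S c x \<inter> branch S d y = {}" by blast
    then have "card (branch S c x) + card (branch S d y) = card (branch S c x \<union> branch S d y)"
      by (intro card_Un_disjoint[symmetric] finite_subset[OF branch_subset fin])
    also have "\<dots> \<le> card S" using branch_subset by (intro card_mono fin) blast
    finally show False using b y by (simp add: big_def)
  next
    case False
    then have dcy: "d \<in> P c y" using side yV by blast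
    have "u \<in> branch S c x" if u: "u \<in> branch S d y" for u
    proof (rule ccontr)
      have uV: "u \<in> V" using u S convex_subset by (auto simp: branch_def)
      assume "u \<notin> branch S c x"
      then have cux: "c \<in> P u x" using u by (auto simp: branch_def)
      then have "c \<in> P u d" using path_between[OF uV V(2)] d(1) by blast
      then have "d \<notin> P u c" using path_split_Int[OF uV dV, of c] Pcd d(2) by auto
      then have "d \<in> P u y"
        using dcy path_triangle[OF V(1) yV uV] path_commute[OF uV V(1)] by blast
      then show False using u by (simp add: branch_def)
    qed
    moreover have "d \<in> branch S c x" "d \<notin> branch S d y"
      using dS cdx start_in_path dV yV by (auto simp: branch_def)
    ultimately have "branch S d y \<subset> branch S c x" by blast
    then have "card (branch S d y) < card (branch S c x)"
      by (intro psubset_card_mono finite_subset[OF branch_subset fin])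
    then show False using min[OF y] by simp
  qed
qed

end

subsection \<open>Optimal hierarchical labelings\<close>

text \<open>\<open>hub_optimal\<close> compares with every labeling, hierarchical or not; the
  modified labeling in \<open>exchange\<close> is not claimed to be hierarchical.\<close>

locale optimal_hierarchy = path_system V P for V :: "'a set" and P +
  fixes H :: "'a \<Rightarrow> 'a set"
  assumes hub_subset: "u \<in> V \<Longrightarrow> H u \<subseteq> V"
    and hub_cover: "\<lbrakk>u \<in> V; v \<in> V\<rbrakk> \<Longrightarrow> H u \<inter> H v \<inter> P u v \<noteq> {}"
    and hub_antisym: "\<lbrakk>u \<in> V; v \<in> V; u \<in> H v; v \<in> H u\<rbrakk> \<Longrightarrow> u = v"
    and hub_trans: "\<lbrakk>u \<in> V; v \<in> V; w \<in> V; u \<in> H v; v \<in> H w\<rbrakk> \<Longrightarrow> u \<in> H w"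
    and hub_optimal: "\<lbrakk>\<And>u. u \<in> V \<Longrightarrow> H' u \<subseteq> V;
      \<And>u v. \<lbrakk>u \<in> V; v \<in> V\<rbrakk> \<Longrightarrow> H' u \<inter> H' v \<inter> P u v \<noteq> {}\<rbrakk> \<Longrightarrow>
      (\<Sum>u\<in>V. card (H u)) \<le> (\<Sum>u\<in>V. card (H' u))"
begin

section \<open>Separated sets and the exchange inequality\<close>

lemma finite_hub: "u \<in> V \<Longrightarrow> finite (H u)"
  using hub_subset finite_V finite_subset by metis

text \<open>For vertices of S, the hubs inside S may be rearranged with only the pairs within S to
  care for.\<close>

definition separated :: "'a set \<Rightarrow> bool" where
  "separated S \<longleftrightarrow> convex S \<and> (\<forall>u\<in>S. \<forall>v\<in>V - S. H u \<inter> H v \<inter> P u v - S \<noteq> {})"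

lemma separated_V: "separated V"
  using path_subset by (auto simp: separated_def convex_def)

text \<open>Promoting c costs each u in S at most one new hub and saves the hubs counted on the
  left. The result is again a labeling, so by optimality the total saving is at most
  \<open>card S\<close>.\<close>

lemma exchange:
  assumes S: "separated S" and c: "c \<in> S"
  shows "(\<Sum>u\<in>S. card {x \<in> H u \<inter> S. c \<in> P u x}) \<le> card S"
proof -
  define X where "X u = {x \<in> H u \<inter> S. c \<in> P u x}" for u
  define H' where "H' u = (if u \<in> S then insert c (H u - X u) else H u)" for u
  have conv: "convex S" using S by (simp add: separated_def)
  have SV: "S \<subseteq> V" using conv by (rule convex_subset)
  \<comment> \<open>Only hubs inside S are dropped, so the hub outside S that separation provides
    survives.\<close>
  have out: "H' u \<inter> H' v \<inter> P u v \<noteq> {}" if "u \<in> S" "v \<in> V - S" for u v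
    using S that unfolding separated_def H'_def X_def by fastforce
  have inn: "H' u \<inter> H' v \<inter> P u v \<noteq> {}" if uv: "u \<in> S" "v \<in> S" for u v
  proof (cases "c \<in> P u v")
    case True
    then show ?thesis using uv by (auto simp: H'_def)
  next
    case False
    have V: "u \<in> V" "v \<in> V" using uv SV by auto
    \<comment> \<open>The path avoids c, so its old hub w is not beyond c from either end and is
      kept by both.\<close>
    obtain w where w: "w \<in> H u" "w \<in> H v" "w \<in> P u v" using hub_cover[OF V] by blast
    have "w \<in> V" using in_path_V V w by blast
    then have "c \<notin> P u w" "c \<notin> P v w"
      using path_split[OF V w(3)] path_commute[of v w] V False by auto
    then have "w \<in> H' u \<inter> H' v \<inter> P u v" using w uv by (simp add: H'_def X_def)
    then show ?thesis by blast
  qed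
  have "H' u \<inter> H' v \<inter> P u v \<noteq> {}" if "u \<in> V" "v \<in> V" for u v
  proof -
    consider "u \<in> S" "v \<in> S" | "u \<in> S" "v \<notin> S" | "u \<notin> S" "v \<in> S" | "u \<notin> S" "v \<notin> S" by blast
    then show ?thesis
    proof cases
      case 3
      then show ?thesis using out[of v u] path_commute that by (simp add: Int_commute)
    qed (use that out inn hub_cover in \<open>auto simp: H'_def\<close>)
  qed
  moreover have "H' u \<subseteq> V" if "u \<in> V" for u
    using hub_subset[OF that] c SV by (auto simp: H'_def)
  ultimately have "(\<Sum>u\<in>V. card (H u)) \<le> (\<Sum>u\<in>V. card (H' u))"
    by (intro hub_optimal)
  moreover have split: "(\<Sum>u\<in>V. f u) = (\<Sum>u\<in>V - S. f u) + (\<Sum>u\<in>S. f u)" for f :: "'a \<Rightarrow> nat"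
    using SV finite_V by (rule sum.subset_diff)
  moreover have "(\<Sum>u\<in>V - S. card (H' u)) = (\<Sum>u\<in>V - S. card (H u))"
    by (intro sum.cong) (auto simp: H'_def)
  ultimately have le: "(\<Sum>u\<in>S. card (H u)) \<le> (\<Sum>u\<in>S. card (H' u))"
    by simp
  have "card (H' u) + card (X u) \<le> 1 + card (H u)" if u: "u \<in> S" for u
  proof -
    have f: "finite (H u)" using finite_hub u SV by blast
    have "X u \<subseteq> H u" by (auto simp: X_def)
    then have "card (H u - X u) + card (X u) = card (H u)"
      using f by (metis card_Diff_subset card_mono finite_subset le_add_diff_inverse2)
    moreover have "card (insert c (H u - X u)) \<le> 1 + card (H u - X u)"
      by (simp add: card_insert_le_m1 card_insert_if f)
    ultimately show ?thesis using u by (simp add: H'_def)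
  qed
  then have "(\<Sum>u\<in>S. card (H' u) + card (X u)) \<le> (\<Sum>u\<in>S. 1 + card (H u))"
    by (rule sum_mono)
  then have "(\<Sum>u\<in>S. card (X u)) \<le> card S"
    using le by (simp only: sum.distrib sum_constant) simp
  then show ?thesis by (simp add: X_def)
qed

section \<open>Chain decomposition of the hub sets\<close>

lemma least_exists:
  assumes S: "convex S" "S \<noteq> {}"
  obtains r where "r \<in> S" "\<And>v. v \<in> S \<Longrightarrow> r \<in> H v"
proof -
  have SV: "S \<subseteq> V" and fin: "finite S" using S convex_subset convex_finite by auto
  \<comment> \<open>\<open>H v\<close> is the down-set of v in the hierarchy, so a vertex with
    fewest hubs is minimal in S. It is even least, because convexity puts the common hub of r and v
    on their path into S.\<close>
  obtain r where r: "r \<in> S" and min: "\<And>v. v \<in> S \<Longrightarrow> card (H r) \<le> card (H v)"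
    using ex_is_arg_min_if_finite[OF fin S(2), of "\<lambda>v. card (H v)"]
    unfolding is_arg_min_linorder by metis
  have rV: "r \<in> V" using r SV by blast
  have "r \<in> H v" if v: "v \<in> S" for v
  proof -
    have vV: "v \<in> V" using v SV by blast
    obtain w where w: "w \<in> H r" "w \<in> H v" "w \<in> P r v" using hub_cover[OF rV vV] by blast
    have wS: "w \<in> S" using w r v S by (auto simp: convex_def)
    then have wV: "w \<in> V" using SV by blast
    \<comment> \<open>By transitivity; minimality then makes the two sets equal, so r is a hub of w
      and antisymmetry gives w = r.\<close>
    have "H w \<subseteq> H r" using hub_trans[OF _ wV rV] hub_subset[OF wV] w by blast
    then have "H w = H r" using min[OF wS] card_seteq finite_hub[OF rV] by blast
    moreover have "r \<in> H r" using hub_cover[OF rV rV] path_refl[OF rV] by auto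
    ultimately have "r = w" using hub_antisym[OF rV wV] w by blast
    then show ?thesis using w by simp
  qed
  then show thesis using that r by blast
qed

text \<open>Apply \<open>exchange\<close> with c = r: each v in S has r itself among the counted
  hubs, so the bound \<open>card S\<close> leaves room for nothing else. Hence every hub of u in S
  other than r lies in the branch of u.\<close>

lemma hub_decomposition:
  assumes S: "separated S" and r: "r \<in> S" "\<And>v. v \<in> S \<Longrightarrow> r \<in> H v" and u: "u \<in> S"
  shows "H u \<inter> S = insert r (H u \<inter> branch S r u)" "separated (branch S r u)"
proof -
  define X where "X v = {x \<in> H v \<inter> S. r \<in> P v x}" for v
  have conv: "convex S" using S by (simp add: separated_def)
  have SV: "S \<subseteq> V" and fin: "finite S" using conv convex_subset convex_finite by auto
  have finX: "finite (X v)" for v using fin by (simp add: X_def)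
  have rX: "r \<in> X v" if "v \<in> S" for v
    using that r end_in_path SV by (auto simp: X_def)
  have "card (X u) \<le> 1"
  proof (rule ccontr)
    assume "\<not> card (X u) \<le> 1"
    then have "(\<Sum>v\<in>S. 1) < (\<Sum>v\<in>S. card (X v))"
      using rX finX u fin
      by (intro sum_strict_mono_ex1) (auto simp: Suc_le_eq card_gt_0_iff intro!: bexI[of _ u])
    then show False using exchange[OF S r(1)] by (simp add: X_def)
  qed
  then have "X u = {r}"
    using rX[OF u] finX[of u] card_le_Suc0_iff_eq[of "X u"] by auto
  then have "{x \<in> H u \<inter> S. r \<in> P u x} = {r}" by (simp add: X_def)
  moreover have "P u x = P x u" if "x \<in> S" for x using path_commute that u SV by blast
  ultimately show "H u \<inter> S = insert r (H u \<inter> branch S r u)"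
    unfolding branch_def by blast
  show "separated (branch S r u)"
    unfolding separated_def
  proof (intro conjI ballI convex_branch conv u)
    fix a b assume a: "a \<in> branch S r u" and b: "b \<in> V - branch S r u"
    then have aS: "a \<in> S" and aV: "a \<in> V" and uV: "u \<in> V" using SV u by (auto simp: branch_def)
    show "H a \<inter> H b \<inter> P a b - branch S r u \<noteq> {}"
    proof (cases "b \<in> S")
      case True
      then have "r \<in> P b u" using b by (auto simp: branch_def)
      \<comment> \<open>The path from b to u passes through r and the one from a to u does not, so r
        lies between a and b. Being a hub of both, it serves the pair from outside the
        branch.\<close>
      then have "r \<in> P a b"
        using a path_triangle[of b u a] path_commute[of a b] aV uV b by (auto simp: branch_def)
      moreover have "r \<notin> branch S r u" using start_in_path r SV uV by (auto simp: branch_def)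
      ultimately show ?thesis using r True aS by blast
    next
      case False
      then have "H a \<inter> H b \<inter> P a b - S \<noteq> {}" using S aS b by (simp add: separated_def)
      then show ?thesis using branch_subset by fast
    qed
  qed
qed

text \<open>Iterates \<open>hub_decomposition\<close> k times. R collects the removed vertices, one
  hub of u each; the first alternative absorbs the case that u itself gets removed. That all of S'
  shares R is what \<open>shrink\<close> asks for.\<close>

lemma descend:
  assumes S: "separated S" "u \<in> S"
  shows "card (H u \<inter> S) \<le> k \<or>
    (\<exists>S' R. separated S' \<and> u \<in> S' \<and> S' \<subseteq> S \<and> R \<subseteq> S - S' \<and> card R = k \<and>
      (\<forall>v\<in>S'. R \<subseteq> H v) \<and> card (H u \<inter> S) = k + card (H u \<inter> S'))"
proof (induction k)
  case 0
  show ?case using S by (intro disjI2 exI[of _ S] exI[of _ "{}"]) auto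
next
  case (Suc k)
  then show ?case
  proof (elim disjE exE conjE)
    fix S' R
    assume S': "separated S'" "u \<in> S'" "S' \<subseteq> S" and R: "R \<subseteq> S - S'" "card R = k" "\<forall>v\<in>S'. R \<subseteq> H v"
      and card: "card (H u \<inter> S) = k + card (H u \<inter> S')"
    have conv: "convex S'" using S' by (simp add: separated_def)
    then obtain r where r: "r \<in> S'" "\<And>v. v \<in> S' \<Longrightarrow> r \<in> H v"
      using least_exists[of S'] S' by blast
    let ?B = "branch S' r u"
    have V: "r \<in> V" "u \<in> V" using r S' conv convex_subset by auto
    have rB: "r \<notin> ?B" using start_in_path V by (simp add: branch_def)
    note dec = hub_decomposition[OF S'(1) r S'(2)]
    have "finite (H u \<inter> ?B)" using finite_hub V by blast
    then have card': "card (H u \<inter> S) = Suc k + card (H u \<inter> ?B)"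
      using card dec(1) rB by simp
    show ?thesis
    proof (cases "u = r")
      case True
      then have "?B = {}" using end_in_path conv convex_subset V by (auto simp: branch_def)
      then show ?thesis using card' by simp
    next
      case False
      have "u \<in> ?B" using S' False path_refl V by (simp add: branch_def)
      moreover have "card (insert r R) = Suc k"
        using R r finite_subset[OF R(1)] convex_finite S(1) by (auto simp: separated_def card_insert_if)
      moreover have BS': "?B \<subseteq> S'" by (rule branch_subset)
      moreover have "\<forall>v\<in>?B. insert r R \<subseteq> H v" using r R(3) BS' by (simp add: subset_iff)
      moreover have "insert r R \<subseteq> S - ?B" using R(1) r(1) rB S'(3) BS' by auto
      ultimately show ?thesis
        using dec(2) card' order_trans[OF BS' S'(3)]
        by (intro disjI2 exI[of _ ?B] exI[of _ "insert r R"] conjI)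
    qed
  qed auto
qed

text \<open>Double counting of the pairs v in S', x in R with c on \<open>P v x\<close>. With k hubs
  in R the factor would be 1/2 + 1/k; k = 4 gives 3/4. The centroid is one of S, not of S', because
  \<open>exchange\<close> is applied in S.\<close>

lemma shrink:
  assumes S: "separated S" "S' \<subseteq> S" "S' \<noteq> {}" and R: "R \<subseteq> S" "card R = 4" "\<And>v. v \<in> S' \<Longrightarrow> R \<subseteq> H v"
  shows "4 * card S' \<le> 3 * card S"
proof -
  have conv: "convex S" using S by (simp add: separated_def)
  have SV: "S \<subseteq> V" and fin: "finite S" using conv convex_subset convex_finite by auto
  have fin': "finite S'" "finite R" using finite_subset[OF _ fin] S R by blast+
  obtain c where c: "c \<in> S" "\<And>x. x \<in> S \<Longrightarrow> 2 * card (branch S c x) \<le> card S"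
    using centroid_exists[OF conv] S by blast
  \<comment> \<open>The vertices of S' whose path to x misses c lie in one branch at c, hence number
    at most half of S. The factor 2 avoids division.\<close>
  have low: "2 * card S' \<le> 2 * card {u \<in> S'. c \<in> P u x} + card S" if x: "x \<in> R" for x
  proof -
    have "card S' \<le> card ({u \<in> S'. c \<in> P u x} \<union> branch S c x)"
      using S fin fin' by (intro card_mono) (auto simp: branch_def)
    also have "\<dots> \<le> card {u \<in> S'. c \<in> P u x} + card (branch S c x)" by (rule card_Un_le)
    finally show ?thesis using c(2)[of x] x R by auto
  qed
  have "(\<Sum>x\<in>R. 2 * card S') \<le> (\<Sum>x\<in>R. 2 * card {u \<in> S'. c \<in> P u x} + card S)"
    using low by (rule sum_mono)
  then have "8 * card S' \<le> 2 * (\<Sum>x\<in>R. card {u \<in> S'. c \<in> P u x}) + 4 * card S"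
    using R by (simp add: sum.distrib sum_distrib_left)
  also have "(\<Sum>x\<in>R. card {u \<in> S'. c \<in> P u x}) = (\<Sum>u\<in>S'. card {x \<in> R. c \<in> P u x})"
    by (rule sum_multicount_gen[OF fin'(2,1)]) simp
  also have "\<dots> \<le> (\<Sum>u\<in>S'. card {x \<in> H u \<inter> S. c \<in> P u x})"
    using R fin by (intro sum_mono card_mono) auto
  also have "\<dots> \<le> (\<Sum>u\<in>S. card {x \<in> H u \<inter> S. c \<in> P u x})"
    using S fin by (intro sum_mono2) auto
  also have "\<dots> \<le> card S" by (rule exchange[OF S(1) c(1)])
  finally show ?thesis by simp
qed

text \<open>Each round of four hubs shrinks the set by a factor 3/4, which lowers the logarithm to
  base 4/3 by at least 1. The additive 4 pays for the last round, where at most four hubs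
  remain.\<close>

lemma hub_card_le:
  assumes "separated S" "u \<in> S"
  shows "real (card (H u \<inter> S)) \<le> 4 + 4 * log (4/3) (real (card S))"
  using assms
proof (induction "card S" arbitrary: S rule: less_induct)
  case less
  have "finite S" using less.prems convex_finite by (auto simp: separated_def)
  then have pos: "0 < card S" using less.prems by (auto simp: card_gt_0_iff)
  from descend[OF less.prems, of 4] show ?case
  proof (elim disjE exE conjE)
    assume "card (H u \<inter> S) \<le> 4"
    moreover have "0 \<le> log (4/3) (real (card S))" using pos by simp
    ultimately show ?thesis by linarith
  next
    fix S' R
    assume S': "separated S'" "u \<in> S'" "S' \<subseteq> S" and R: "R \<subseteq> S - S'" "card R = 4" "\<forall>v\<in>S'. R \<subseteq> H v"
      and card: "card (H u \<inter> S) = 4 + card (H u \<inter> S')"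
    have le: "4 * card S' \<le> 3 * card S"
      using S' R by (intro shrink[OF less.prems(1)]) auto
    have pos': "0 < card S'" using S' \<open>finite S\<close> finite_subset by (auto simp: card_gt_0_iff)
    have "log (4/3) (real (card S')) + 1 = log (4/3) (real (card S') * (4/3))"
      using pos' log_mult_pos[of "real (card S')" "4/3" "4/3"] by simp
    also have "\<dots> \<le> log (4/3) (real (card S))"
      using le pos' by (intro log_mono) auto
    finally have "log (4/3) (real (card S')) + 1 \<le> log (4/3) (real (card S))" .
    moreover have "real (card (H u \<inter> S')) \<le> 4 + 4 * log (4/3) (real (card S'))"
      using le pos' by (intro less.hyps[OF _ S'(1,2)]) linarith
    moreover have "real (card (H u \<inter> S)) = 4 + real (card (H u \<inter> S'))" using card by simp
    ultimately show ?thesis by linarith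
  qed
qed

end

subsection \<open>Paths in trees\<close>

context pair_graph
begin

text \<open>Paths are lists of vertices but cycles are lists of arcs; this passes from the first
  form to the second.\<close>

lemma awalk_vwalk_arcs:
  assumes "vwalk p (with_proj G)"
  shows "awalk (hd p) (vwalk_arcs p) (last p)" "pawalk_verts (hd p) (vwalk_arcs p) = p"
proof -
  have ne: "p \<noteq> []" and V: "set p \<subseteq> pverts G" and A: "set (vwalk_arcs p) \<subseteq> parcs G"
    using assms by (auto simp: vwalk_def)
  have "pcas (hd p) (vwalk_arcs p) (last p) \<and> pawalk_verts (hd p) (vwalk_arcs p) = p"
    using ne by (induction p rule: vwalk_arcs.induct) auto
  then show "awalk (hd p) (vwalk_arcs p) (last p)" "pawalk_verts (hd p) (vwalk_arcs p) = p"
    using ne V A by (auto simp: awalk_def)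
qed

lemma vpath_rev: "vpath p (with_proj G) \<Longrightarrow> vpath (rev p) (with_proj G)"
  using vwalk_rev_ex[OF pair_sym_arcs] by (auto simp: vpath_def)

end

locale acyclic_pair_graph = pair_graph +
  assumes acyclic: "\<not> (\<exists>p. cycle p \<and> 3 \<le> length p)"
begin

text \<open>Induction on the length of p. If p and q share an inner vertex w, their parts before and
  after w agree by induction. Otherwise, for distinct ends, p followed by q backwards repeats no
  vertex but its start, so it is a cycle and must be short.\<close>

lemma vpath_unique:
  assumes "vpath p (with_proj G)" "vpath q (with_proj G)" "hd p = hd q" "last p = last q"
  shows "p = q"
  using assms
proof (induction "length p" arbitrary: p q rule: less_induct)
  case less
  define u v where "u = hd p" and "v = last p"
  have ne: "p \<noteq> []" "q \<noteq> []" and dist: "distinct p" "distinct q"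
    and walk: "vwalk p (with_proj G)" "vwalk q (with_proj G)"
    using less.prems by (auto simp: vpath_def vwalk_def)
  have ends: "hd p = u" "last p = v" "hd q = u" "last q = v"
    using less.prems by (auto simp: u_def v_def)
  show ?case
  proof (cases "\<exists>w. w \<in> set p \<inter> set q \<and> w \<noteq> u \<and> w \<noteq> v")
    case True
    then obtain w p1 p2 q1 q2 where w: "w \<noteq> u" "w \<noteq> v"
      and p: "p = p1 @ w # p2" and q: "q = q1 @ w # q2"
      by (metis IntE split_list)
    have ne': "p1 \<noteq> []" "p2 \<noteq> []" "q1 \<noteq> []" "q2 \<noteq> []"
      using w ends by (auto simp: p q)
    have "vwalk (p1 @ [w]) (with_proj G)" "vwalk (q1 @ [w]) (with_proj G)"
      using walk vwalkI_append_l[of "_ @ [w]" _ "with_proj G"] by (auto simp: p q)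
    then have "p1 @ [w] = q1 @ [w]"
      using ne' dist ends by (intro less.hyps) (auto simp: p q vpath_def hd_append)
    moreover have "vwalk (w # p2) (with_proj G)" "vwalk (w # q2) (with_proj G)"
      using walk vwalkI_append_r[of "w # _" _ "with_proj G"] unfolding p q by blast+
    then have "w # p2 = w # q2"
      using ne' dist ends by (intro less.hyps) (auto simp: p q vpath_def)
    ultimately show ?thesis by (simp add: p q)
  next
    case False
    show ?thesis
    proof (cases "u = v")
      case True
      have "r = [u]" if "r \<noteq> []" "distinct r" "hd r = u" "last r = u" for r
        using that by (cases r) (auto split: if_splits)
      then show ?thesis using ne dist ends True by metis
    next
      case uv: False
      have shape: "\<exists>s. r = u # s @ [v]" if "r \<noteq> []" "hd r = u" "last r = v" for r
        using that uv by (metis append_butlast_last_id hd_Cons_tl last_ConsL last_tl)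
      obtain p' q' where p: "p = u # p' @ [v]" and q: "q = u # q' @ [v]"
        using shape ne ends by metis
      \<comment> \<open>\<open>tl\<close> drops the second copy of the shared end v.\<close>
      define c where "c = p @ tl (rev q)"
      have c: "c = u # p' @ v # rev q' @ [u]" by (simp add: c_def p q)
      have "vwalk (rev q) (with_proj G)" by (rule vwalk_rev_ex[OF pair_sym_arcs walk(2)])
      moreover have "joinable p (rev q)" using ne ends by (simp add: joinable_def hd_rev)
      ultimately have "vwalk c (with_proj G)"
        using walk vwalk_joinI_vwalk[of p "with_proj G" "rev q"] by (simp add: c_def vwalk_join_def)
      then have "awalk u (vwalk_arcs c) u" "pawalk_verts u (vwalk_arcs c) = c"
        using awalk_vwalk_arcs[of c] by (simp_all add: c)
      moreover have "distinct (tl c)" using False dist by (auto simp: c p q)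
      ultimately have "cycle (vwalk_arcs c)" by (auto simp: cycle_def c)
      \<comment> \<open>The closed walk has \<open>length p' + length q' + 2\<close> arcs, so fewer
        than 3 arcs force both paths to be the edge from u to v.\<close>
      then have "\<not> 3 \<le> vwalk_length c" using acyclic by (metis vwalk_length_def)
      then have "p' = []" "q' = []" by (auto simp: c Suc_le_eq)
      then show ?thesis by (simp add: p q)
    qed
  qed
qed

text \<open>Uniqueness lets any path at hand evaluate the definite description.\<close>

lemma path_verts_eq:
  assumes "vpath p (with_proj G)" "hd p = u" "last p = v"
  shows "path_verts G u v = set p"
proof -
  have "(THE p. vpath p (with_proj G) \<and> hd p = u \<and> last p = v) = p"
    using assms by (intro the_equality) (auto intro: vpath_unique)
  then show ?thesis by (simp add: path_verts_def)
qed

end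

text \<open>Connectedness gives a path for each pair, since arcs come in both directions. Cutting
  its list at w gives the two split axioms; concatenating paths that share only w gives
  \<open>path_join\<close>, by uniqueness.\<close>

lemma undirected_tree_path_system:
  assumes T: "undirected_tree T"
  shows "path_system (pverts T) (path_verts T)"
proof -
  interpret pair_graph T using T by (simp add: undirected_tree_def)
  interpret acyclic_pair_graph T
    using T by unfold_locales (simp add: undirected_tree_def)
  have conn: "strongly_connected (with_proj T)"
    using symmetric_connected_imp_strongly_connected[OF pair_sym_arcs] T
    by (simp add: undirected_tree_def)
  have ex: "\<exists>p. vpath p (with_proj T) \<and> hd p = u \<and> last p = v \<and> p \<noteq> [] \<and> path_verts T u v = set p"
    if "u \<in> pverts T" "v \<in> pverts T" for u v
  proof -
    have "u \<rightarrow>\<^sup>*\<^bsub>with_proj T\<^esub> v" using conn that by auto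
    then obtain p where p: "vpath p (with_proj T)" "hd p = u" "last p = v"
      unfolding reachable_vpath_conv by blast
    moreover have "p \<noteq> []" using p by (auto simp: vpath_def vwalk_def)
    ultimately show ?thesis using path_verts_eq by blast
  qed
  have split: "path_verts T u v = path_verts T u w \<union> path_verts T w v \<and>
      path_verts T u w \<inter> path_verts T w v = {w}"
    if uv: "u \<in> pverts T" "v \<in> pverts T" and w: "w \<in> path_verts T u v" for u v w
  proof -
    obtain p where p: "vpath p (with_proj T)" "hd p = u" "last p = v" "path_verts T u v = set p"
      using ex[OF uv] by blast
    obtain p1 p2 where p12: "p = p1 @ w # p2" using w p by (metis split_list)
    have walk: "vwalk p (with_proj T)" "distinct p" using p by auto
    have "vwalk (p1 @ [w]) (with_proj T)" "vwalk (w # p2) (with_proj T)"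
      using walk vwalkI_append_l[of "p1 @ [w]" p2] vwalkI_append_r[of "w # p2" p1]
      by (simp_all add: p12)
    then have "path_verts T u w = set (p1 @ [w])" "path_verts T w v = set (w # p2)"
      using p walk by (intro path_verts_eq; auto simp: p12 hd_append vpath_def)+
    then show ?thesis using p walk by (auto simp: p12)
  qed
  show ?thesis
  proof
    show "finite (pverts T)" by (rule pair_finite_verts)
  next
    fix u v assume uv: "u \<in> pverts T" "v \<in> pverts T"
    obtain p where p: "vpath p (with_proj T)" "hd p = u" "last p = v" "p \<noteq> []" "path_verts T u v = set p"
      using ex[OF uv] by blast
    show "path_verts T u v \<subseteq> pverts T" using p by (auto simp: vpath_def vwalk_def)
    show "u \<in> path_verts T u v" using p hd_in_set by metis
    have "path_verts T v u = set (rev p)"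
      using p by (intro path_verts_eq vpath_rev) (simp_all add: hd_rev last_rev)
    then show "path_verts T u v = path_verts T v u" using p by simp
  next
    fix u v w assume uv: "u \<in> pverts T" "v \<in> pverts T" "w \<in> pverts T"
      and disj: "path_verts T u w \<inter> path_verts T w v \<subseteq> {w}"
    obtain p where p: "vpath p (with_proj T)" "hd p = u" "last p = w" "p \<noteq> []" "path_verts T u w = set p"
      using ex[OF uv(1,3)] by blast
    obtain q where q: "vpath q (with_proj T)" "hd q = w" "last q = v" "q \<noteq> []" "path_verts T w v = set q"
      using ex[OF uv(3,2)] by blast
    have walk: "vwalk p (with_proj T)" "distinct p" "vwalk q (with_proj T)" "distinct q"
      using p q by auto
    obtain q' where q': "q = w # q'" using q by (cases q) auto
    have join: "joinable p q" using p q by (simp add: joinable_def)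
    have "vwalk (p \<oplus> q) (with_proj T)" by (rule vwalk_joinI_vwalk[OF walk(1,3) join])
    moreover have "distinct (p \<oplus> q)"
      using walk disj p q by (auto simp: vwalk_join_def q')
    ultimately have "path_verts T u v = set (p \<oplus> q)"
      using p q join by (intro path_verts_eq) (auto simp: vwalk_join_hd vwalk_join_last)
    moreover have "w \<in> set p" using p last_in_set by metis
    ultimately show "w \<in> path_verts T u v" by (simp add: vwalk_join_def)
  qed (use split in blast)+
qed

subsection \<open>The logarithmic bound\<close>

lemma optimal_hierarchyI:
  assumes "undirected_tree T" "hierarchical T H" "HL1_optimal T H"
  shows "optimal_hierarchy (pverts T) (path_verts T) H"
proof -
  interpret path_system "pverts T" "path_verts T"
    using assms(1) by (rule undirected_tree_path_system)
  have lab: "hub_labeling T H"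
    and opt: "\<And>H'. hub_labeling T H' \<Longrightarrow> HL1_cost T H \<le> HL1_cost T H'"
    using assms(3) by (auto simp: HL1_optimal_def)
  have "trans (hub_rel T H)" "antisym (hub_rel T H)"
    using assms(2) by (auto simp: hierarchical_def partial_order_on_def preorder_on_def)
  then show ?thesis
    using lab opt
    by unfold_locales
      (auto simp: hub_labeling_def HL1_cost_def hub_rel_def antisym_def trans_def)
qed

text \<open>The constant a is absorbed because ln n \<ge> 1 from n = 3 on, as e \<le> 3; a change of
  base only rescales the logarithm.\<close>

lemma affine_log_bigo_ln:
  fixes a b c :: real
  assumes "1 < c"
  shows "(\<lambda>n. a + b * log c (real n)) \<in> O(\<lambda>n. ln (real n))"
proof -
  have "eventually (\<lambda>n. norm a \<le> norm a * norm (ln (real n))) sequentially"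
    using eventually_ge_at_top[of 3]
  proof eventually_elim
    case (elim n)
    have "1 \<le> ln (real n)" using elim exp_le by (subst ln_ge_iff) auto
    then show ?case by (simp add: mult_le_cancel_left1)
  qed
  then have "(\<lambda>n. a) \<in> O(\<lambda>n. ln (real n))" by (rule bigoI)
  moreover have "(\<lambda>n. b * log c (real n)) \<in> O(\<lambda>n. ln (real n))"
    by (rule bigoI[of _ "norm (b / ln c)"]) (simp add: log_def abs_mult)
  ultimately show ?thesis by (rule sum_in_bigo)
qed

theorem mainTheorem8:
  shows "\<exists>f :: nat \<Rightarrow> real. f \<in> O(\<lambda>n. ln (real n)) \<and>
    (\<forall>(T :: 'a pair_pre_digraph) H.
       undirected_tree T \<longrightarrow> hub_labeling T H \<longrightarrow> hierarchical T H \<longrightarrow> HL1_optimal T H \<longrightarrow>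
       real (MAX u \<in> pverts T. card (H u)) \<le> f (card (pverts T)))"
proof (intro exI conjI allI impI)
  \<comment> \<open>The witness is the bound of \<open>hub_card_le\<close> for the full vertex set.
    It depends on n alone, so the estimate is uniform in T and H.\<close>
  show "(\<lambda>n. 4 + 4 * log (4/3) (real n)) \<in> O(\<lambda>n. ln (real n))"
    by (rule affine_log_bigo_ln) simp
next
  fix T :: "'a pair_pre_digraph" and H
  assume T: "undirected_tree T" and H: "hierarchical T H" "HL1_optimal T H"
  interpret optimal_hierarchy "pverts T" "path_verts T" H
    using T H by (rule optimal_hierarchyI)
  have "pverts T \<noteq> {}"
    using T by (auto simp: undirected_tree_def connected_def strongly_connected_def)
  then have "(MAX u \<in> pverts T. card (H u)) \<in> (\<lambda>u. card (H u)) ` pverts T"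
    using finite_V by (intro Max_in) auto
  then obtain u where u: "u \<in> pverts T" and max: "(MAX u \<in> pverts T. card (H u)) = card (H u)"
    by blast
  have "H u \<inter> pverts T = H u" using hub_subset[OF u] by blast
  then show "real (MAX u \<in> pverts T. card (H u)) \<le> 4 + 4 * log (4/3) (real (card (pverts T)))"
    using hub_card_le[OF separated_V u] max by simp
qed

end
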